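(* Let $q=2^h$, $m\ge1$, and on $\mathbb{F}_q^{2m}$ let $\langle u,v\rangle=uFv^T$ with $F=\begin{pmatrix}0&I_m\\ I_m&0\end{pmatrix}$, $\vartheta_0(u)=uEu^T$ with $E=\begin{pmatrix}0&I_m\\0&0\end{pmatrix}$, and $\vartheta_a(u)=\vartheta_0(u)+\langle a,u\rangle^2$. Let $W^+=\{a\in\mathbb{F}_q^{2m}:\mathrm{Tr}_{\mathbb{F}_q/\mathbb{F}_2}(\vartheta_0(a))=0\}$, $W^-=\{a\in\mathbb{F}_q^{2m}:\mathrm{Tr}_{\mathbb{F}_q/\mathbb{F}_2}(\vartheta_0(a))=1\}$, and $F=\{(a,b)\in W^\pm\times W^\pm:\vartheta_a(a+b)=0,\ a\ne b\}$. Then the graph $(W^\pm,F)$ is isomorphic to $NO^{\pm}(2m+1,q)$.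
   Context: $NO^{\pm}(2m+1,q)$ ($q$ even): take a non-singular parabolic quadric $Q(2m,q)$ in $PG(2m,q)$ (zero set of a quadratic form on $\mathbb{F}_q^{2m+1}$ of maximal Witt index $m$), whose polar form has a 1-dimensional radical spanning the nucleus $N$. The vertices are the hyperplanes $H$ with $N\notin H$ such that $H\cap Q(2m,q)$ is a non-singular quadric in $H$ of type $\pm1$ (hyperbolic/elliptic); two vertices $H_1,H_2$ are adjacent iff $H_1\cap H_2\cap Q(2m,q)$ is degenerate (singular in $H_1\cap H_2$). *)

theory Defs
  imports "HOL-Analysis.Analysis"
begin

section \<open>Ambient vector spaces over a finite field\<close>

text \<open>F_q^{2m} is modelled as 'a ^ ('m + 'm), with m = CARD('m); coordinate Inl i is
  position i and Inr i is position m+i (i = 1..m).  F_q^{2m+1} is modelled as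
  'a ^ (('m + 'm) + unit), the extra coordinate being Inr ().\<close>

text \<open>The bilinear expression u M v^T.\<close>
definition bform :: "'a::field ^ 'n ^ 'n \<Rightarrow> 'a ^ 'n \<Rightarrow> 'a ^ 'n \<Rightarrow> 'a" where
  "bform M u v = (\<Sum>i\<in>UNIV. (u v* M) $ i * v $ i)"

text \<open>E = (0 I_m; 0 0) and F = (0 I_m; I_m 0).\<close>
definition matE :: "'a::field ^ ('m::finite + 'm) ^ ('m + 'm)" where
  "matE = (\<chi> i j. if (\<exists>k. i = Inl k \<and> j = Inr k) then 1 else 0)"

definition matF :: "'a::field ^ ('m::finite + 'm) ^ ('m + 'm)" where
  "matF = (\<chi> i j. if (\<exists>k. (i = Inl k \<and> j = Inr k) \<or> (i = Inr k \<and> j = Inl k)) then 1 else 0)"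

definition pairing :: "'a::field ^ ('m::finite + 'm) \<Rightarrow> 'a ^ ('m + 'm) \<Rightarrow> 'a" where
  "pairing u v = bform matF u v"

definition theta0 :: "'a::field ^ ('m::finite + 'm) \<Rightarrow> 'a" where
  "theta0 u = bform matE u u"

definition theta :: "'a::field ^ ('m::finite + 'm) \<Rightarrow> 'a ^ ('m + 'm) \<Rightarrow> 'a" where
  "theta a u = theta0 u + (pairing a u)^2"

text \<open>Absolute trace Tr_{F_q/F_2}(x) = x + x^2 + ... + x^(2^(h-1)), where q = 2^h.\<close>
definition trace2 :: "nat \<Rightarrow> 'a::field \<Rightarrow> 'a" where
  "trace2 h x = (\<Sum>i<h. x ^ (2 ^ i))"

text \<open>W^+ (s = True, trace 0) and W^- (s = False, trace 1).\<close>
definition Wset :: "nat \<Rightarrow> bool \<Rightarrow> ('a::field ^ ('m::finite + 'm)) set" where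
  "Wset h s = {a. trace2 h (theta0 a) = (if s then 0 else 1)}"

definition Fedges :: "nat \<Rightarrow> bool \<Rightarrow> (('a::field ^ ('m::finite + 'm)) \<times> ('a ^ ('m + 'm))) set" where
  "Fedges h s = {(a, b). a \<in> Wset h s \<and> b \<in> Wset h s \<and> theta a (a + b) = 0 \<and> a \<noteq> b}"

section \<open>The graph NO^{\<plusminus>}(2m+1,q)\<close>

text \<open>The standard non-singular parabolic quadratic form on F_q^{2m+1}:
  Q(x_1..x_m, y_1..y_m, z) = x_1 y_1 + ... + x_m y_m + z^2 (maximal Witt index m).\<close>
definition Qpar :: "'a::field ^ (('m::finite + 'm) + unit) \<Rightarrow> 'a" where
  "Qpar v = (\<Sum>k\<in>UNIV. v $ Inl (Inl k) * v $ Inl (Inr k)) + (v $ Inr ()) ^ 2"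

text \<open>Polar form of a quadratic form.\<close>
definition polar :: "('v::ab_group_add \<Rightarrow> 'a::field) \<Rightarrow> 'v \<Rightarrow> 'v \<Rightarrow> 'a" where
  "polar Q u v = Q (u + v) - Q u - Q v"

text \<open>The nucleus N is the (1-dimensional) radical of the polar form; N not in H.\<close>
definition nucleus_not_in :: "('a::field ^ 'n \<Rightarrow> 'a) \<Rightarrow> ('a ^ 'n) set \<Rightarrow> bool" where
  "nucleus_not_in Q H = (\<exists>n. (\<forall>w. polar Q n w = 0) \<and> n \<notin> H)"

text \<open>Hyperplanes of PG(n-1,q), as (n-1)-dimensional subspaces of F_q^n.\<close>
definition hyperplane :: "('a::field ^ 'n::finite) set \<Rightarrow> bool" where
  "hyperplane H = (vec.subspace H \<and> vec.dim H = CARD('n) - 1)"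

text \<open>The quadric Q restricted to a subspace S is singular (degenerate): it has a singular
  point, i.e. a nonzero singular vector of S lying in the radical of the polar form on S.\<close>
definition singular_on :: "('a::field ^ 'n \<Rightarrow> 'a) \<Rightarrow> ('a ^ 'n) set \<Rightarrow> bool" where
  "singular_on Q S = (\<exists>u\<in>S. u \<noteq> 0 \<and> Q u = 0 \<and> (\<forall>w\<in>S. polar Q u w = 0))"

definition totally_singular_dim :: "('a::field ^ 'n::finite \<Rightarrow> 'a) \<Rightarrow> ('a ^ 'n) set \<Rightarrow> nat \<Rightarrow> bool" where
  "totally_singular_dim Q H d =
     (\<exists>U. vec.subspace U \<and> U \<subseteq> H \<and> vec.dim U = d \<and> (\<forall>u\<in>U. Q u = 0))"

text \<open>Type of a non-singular quadric in a 2m-dimensional space H (projective dimension 2m-1):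
  hyperbolic (+1) iff Witt index m, elliptic (-1) iff Witt index m-1.\<close>
definition quadric_type :: "('a::field ^ 'n::finite \<Rightarrow> 'a) \<Rightarrow> ('a ^ 'n) set \<Rightarrow> nat \<Rightarrow> bool \<Rightarrow> bool" where
  "quadric_type Q H m s =
     (if s then totally_singular_dim Q H m
      else totally_singular_dim Q H (m - 1) \<and> \<not> totally_singular_dim Q H m)"

definition NO_vertices :: "bool \<Rightarrow> ('a::field ^ (('m::finite + 'm) + unit)) set set" where
  "NO_vertices s = {H. hyperplane H \<and> nucleus_not_in Qpar H \<and> \<not> singular_on Qpar H
                        \<and> quadric_type Qpar H CARD('m) s}"

definition NO_adj :: "('a::field ^ (('m::finite + 'm) + unit)) set \<Rightarrow> ('a ^ (('m + 'm) + unit)) set \<Rightarrow> bool" where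
  "NO_adj H1 H2 = singular_on Qpar (H1 \<inter> H2)"

text \<open>Graph isomorphism between (V1, E1) (edges as ordered pairs) and (V2, adj2).\<close>
definition graph_iso :: "'u set \<Rightarrow> ('u \<times> 'u) set \<Rightarrow> 'w set \<Rightarrow> ('w \<Rightarrow> 'w \<Rightarrow> bool) \<Rightarrow> bool" where
  "graph_iso V1 E1 V2 adj2 =
     (\<exists>f. bij_betw f V1 V2 \<and> (\<forall>a\<in>V1. \<forall>b\<in>V1. (a, b) \<in> E1 \<longleftrightarrow> adj2 (f a) (f b)))"

end

theory Submission
  imports Defs "HOL-Number_Theory.Residues" "HOL-Computational_Algebra.Polynomial"
begin

text \<open>For even \<open>q\<close> the polar form of \<open>Q(u, z) = \<vartheta>\<^sub>0(u) + z\<^sup>2\<close> is \<open>\<langle>u, u'\<rangle>\<close>, so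
  the nucleus is the \<open>z\<close>-axis and the hyperplanes missing it are exactly the graphs
  \<open>H\<^sub>a = {(u, \<langle>a, u\<rangle>)}\<close> of linear forms.  On \<open>H\<^sub>a\<close> the quadric becomes \<open>\<vartheta>\<^sub>a\<close>, and
  \<open>H\<^sub>a \<inter> H\<^sub>b\<close> is the graph over \<open>(a + b)\<^sup>\<perp>\<close>, whose radical is spanned by \<open>a + b\<close>: so
  \<open>H\<^sub>a\<close> and \<open>H\<^sub>b\<close> are adjacent iff \<open>\<vartheta>\<^sub>a(a + b) = 0\<close> and \<open>a \<noteq> b\<close>.

  The type of \<open>\<vartheta>\<^sub>a\<close> is its Arf invariant \<open>Tr \<vartheta>\<^sub>0(a)\<close>.  If the trace vanishes, a root of
  \<open>\<mu>\<^sup>2 + \<mu> = \<vartheta>\<^sub>0(a)\<close> yields an isometry from the hyperbolic form \<open>\<vartheta>\<^sub>0\<close> to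
  \<open>\<vartheta>\<^sub>a\<close>.  Conversely, an \<open>m\<close>-dimensional totally singular subspace forces the Gauss
  sum \<open>\<Sum>\<^sub>v (-1)\<^bsup>Tr \<vartheta>\<^sub>a(v)\<^esup>\<close> to be \<open>q\<^sup>m\<close>, while translating by \<open>a\<close> shows that the
  Gauss sum of \<open>\<vartheta>\<^sub>0\<close>, also \<open>q\<^sup>m\<close>, is \<open>(-1)\<^bsup>Tr \<vartheta>\<^sub>0(a)\<^esup>\<close> times it.\<close>

section \<open>Characteristic two and the absolute trace\<close>

lemma two_eq_zero_if_card_eq_power_two:
  assumes "CARD('a::{field,finite}) = 2 ^ h"
  shows "(2::'a) = 0"
proof -
  have "prime CHAR('a)"
    by (rule prime_CHAR_semidom) (simp add: finite_imp_CHAR_pos)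
  moreover have "CHAR('a) dvd 2 ^ h"
    using CHAR_dvd_CARD[where 'a='a] assms by simp
  ultimately have "CHAR('a) = 2"
    by (metis prime_dvd_power primes_dvd_imp_eq two_is_prime_nat)
  then show ?thesis
    using of_nat_CHAR[where 'a='a] by simp
qed

lemma power_card_eq_self:
  fixes x :: "'a::{field,finite}"
  shows "x ^ CARD('a) = x"
proof (cases "x = 0")
  case True
  then show ?thesis by simp
next
  case False
  let ?N = "UNIV - {0::'a}"
  have "bij_betw ((*) x) ?N ?N"
    by (rule bij_betwI[where g = "\<lambda>y. y / x"]) (use False in auto)
  then have "\<Prod>?N = (\<Prod>y\<in>?N. x * y)"
    using prod.reindex_bij_betw[OF \<open>bij_betw _ _ _\<close>, of "\<lambda>y. y"] by simp
  also have "\<dots> = x ^ (CARD('a) - 1) * \<Prod>?N"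
    by (simp add: prod.distrib card_Diff_subset)
  finally have "x ^ (CARD('a) - 1) = 1"
    by simp
  then show ?thesis
    using power_minus_mult[of "CARD('a)" x] by simp
qed

lemma card_eq_power_two_imp_pos:
  assumes "CARD('a::{field,finite}) = 2 ^ h"
  shows "h > 0"
proof -
  have "card {0, 1::'a} \<le> CARD('a)"
    by (rule card_mono) simp_all
  then show ?thesis
    using assms by (cases h) simp_all
qed

lemma char2_add_self: "(2::'a::comm_ring_1) = 0 \<Longrightarrow> x + x = (0::'a)"
  by (metis mult_2 mult_zero_left)

lemma char2_minus: "(2::'a::comm_ring_1) = 0 \<Longrightarrow> - x = (x::'a)"
  by (metis char2_add_self add.inverse_unique)

lemma char2_add_eq_0_iff: "(2::'a::comm_ring_1) = 0 \<Longrightarrow> x + y = 0 \<longleftrightarrow> x = (y::'a)"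
  by (metis add_eq_0_iff char2_minus)

lemma char2_power2_add: "(2::'a::comm_ring_1) = 0 \<Longrightarrow> (x + y)^2 = x^2 + (y::'a)^2"
  by (simp add: power2_sum)

lemma char2_power_two_power_add:
  assumes "(2::'a::comm_ring_1) = 0"
  shows "(x + y) ^ (2 ^ i) = x ^ (2 ^ i) + (y::'a) ^ (2 ^ i)"
proof (induction i)
  case (Suc i)
  have "(x + y) ^ (2 ^ Suc i) = ((x + y) ^ (2 ^ i))^2"
    by (simp only: power_Suc2 power_mult)
  also have "\<dots> = (x ^ (2 ^ i))^2 + (y ^ (2 ^ i))^2"
    by (simp only: Suc char2_power2_add[OF assms])
  finally show ?case
    by (simp only: power_Suc2 power_mult)
qed simp

lemma vec_char2_add_eq_0_iff:
  assumes "(2::'a::comm_ring_1) = 0"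
  shows "x + y = 0 \<longleftrightarrow> x = (y::'a^'n)"
  by (simp add: vec_eq_iff char2_add_eq_0_iff[OF assms])

lemma trace2_0 [simp]: "trace2 h (0::'a::field) = 0"
  by (simp add: trace2_def power_0_left)

lemma trace2_add:
  assumes "(2::'a::field) = 0"
  shows "trace2 h (x + y) = trace2 h x + trace2 h (y::'a)"
  by (simp add: trace2_def char2_power_two_power_add[OF assms] sum.distrib)

lemma trace2_square:
  assumes "CARD('a::{field,finite}) = 2 ^ h"
  shows "trace2 h ((x::'a)^2) = trace2 h x"
proof -
  obtain n where h: "h = Suc n"
    using card_eq_power_two_imp_pos[OF assms] gr0_implies_Suc by blast
  have "x ^ (2 ^ h) = x"
    using power_card_eq_self[of x] assms by simp
  then have "trace2 h (x^2) = x ^ (2 ^ 0) + (\<Sum>i<n. x ^ (2 ^ Suc i))"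
    by (simp add: trace2_def h power_mult[symmetric] mult.commute)
  also have "\<dots> = trace2 h x"
    unfolding trace2_def h sum.lessThan_Suc_shift ..
  finally show ?thesis .
qed

lemma trace2_power2_eq_self:
  assumes "CARD('a::{field,finite}) = 2 ^ h"
  shows "(trace2 h (x::'a))^2 = trace2 h x"
proof -
  have two: "(2::'a) = 0"
    by (rule two_eq_zero_if_card_eq_power_two[OF assms])
  have "(trace2 h x)^2 = trace2 h (x^2)"
    unfolding trace2_def
  proof (induction h)
    case (Suc h)
    then show ?case
      by (simp add: char2_power2_add[OF two] power_mult[symmetric] mult.commute)
  qed simp
  then show ?thesis
    using trace2_square[OF assms] by simp
qed

lemma trace2_eq_0_or_1:
  assumes "CARD('a::{field,finite}) = 2 ^ h"
  shows "trace2 h (x::'a) = 0 \<or> trace2 h x = 1"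
proof -
  have "trace2 h x * (trace2 h x - 1) = 0"
    using trace2_power2_eq_self[OF assms, of x] by (simp add: algebra_simps power2_eq_square)
  then show ?thesis
    by simp
qed

text \<open>The trace is a polynomial of degree \<open>q/2\<close>, so it has at most \<open>q/2\<close> zeros.\<close>

lemma card_trace2_zeros_le:
  assumes "CARD('a::{field,finite}) = 2 ^ h"
  shows "2 * card {x::'a. trace2 h x = 0} \<le> CARD('a)"
proof -
  obtain n where h: "h = Suc n"
    using card_eq_power_two_imp_pos[OF assms] gr0_implies_Suc by blast
  define p :: "'a poly" where "p = (\<Sum>i<h. Polynomial.monom 1 (2 ^ i))"
  have poly_p: "poly p = trace2 h"
    by (simp add: p_def trace2_def poly_sum poly_monom fun_eq_iff)
  have "Polynomial.coeff p (2 ^ n) = (\<Sum>i<h. if i = n then 1 else 0)"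
    by (simp add: p_def coeff_sum coeff_monom)
  then have "p \<noteq> 0"
    by (auto simp: h)
  have "degree p \<le> 2 ^ n"
    unfolding p_def by (rule degree_sum_le) (auto simp: h degree_monom_eq)
  have "card {x. poly p x = 0} \<le> degree p"
    by (rule card_poly_roots_bound[OF \<open>p \<noteq> 0\<close>])
  with \<open>degree p \<le> 2 ^ n\<close> show ?thesis
    by (simp add: poly_p assms h)
qed

lemma trace2_eq_1_exists:
  assumes "CARD('a::{field,finite}) = 2 ^ h"
  shows "\<exists>x::'a. trace2 h x = 1"
proof -
  have "card {x::'a. trace2 h x = 0} < card (UNIV :: 'a set)"
    using card_trace2_zeros_le[OF assms] finite_UNIV_card_ge_0[where 'a='a, OF finite] by linarith
  then have "{x::'a. trace2 h x = 0} \<noteq> UNIV"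
    by auto
  then show ?thesis
    using trace2_eq_0_or_1[OF assms] by blast
qed

lemma card_artin_schreier_fibre_le:
  assumes two: "(2::'a::field) = 0"
  shows "card {\<mu>::'a. \<mu>^2 + \<mu> = s} \<le> 2"
proof (cases "\<exists>\<mu>\<^sub>0. \<mu>\<^sub>0^2 + \<mu>\<^sub>0 = s")
  case True
  then obtain \<mu>\<^sub>0 where s: "\<mu>\<^sub>0^2 + \<mu>\<^sub>0 = s"
    by blast
  have "\<mu> \<in> {\<mu>\<^sub>0, \<mu>\<^sub>0 + 1}" if "\<mu>^2 + \<mu> = s" for \<mu>
  proof -
    have "(\<mu> + \<mu>\<^sub>0) * (\<mu> + (\<mu>\<^sub>0 + 1)) = (\<mu>^2 + \<mu>) + (\<mu>\<^sub>0^2 + \<mu>\<^sub>0) + 2 * (\<mu> * \<mu>\<^sub>0)"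
      by (simp add: algebra_simps power2_eq_square)
    also have "\<dots> = 0"
      using that s two by (simp add: char2_add_self[OF two])
    finally show ?thesis
      by (auto simp: char2_add_eq_0_iff[OF two])
  qed
  then have "card {\<mu>. \<mu>^2 + \<mu> = s} \<le> card {\<mu>\<^sub>0, \<mu>\<^sub>0 + 1}"
    by (intro card_mono) auto
  also have "\<dots> \<le> 2"
    by (rule card_insert_le_m1) simp_all
  finally show ?thesis .
qed simp

text \<open>Additive Hilbert 90: \<open>\<mu> \<mapsto> \<mu>\<^sup>2 + \<mu>\<close> is two-to-one into the kernel of the trace,
  which has at most \<open>q/2\<close> elements, so it is onto that kernel.\<close>

lemma trace2_eq_0_iff:
  assumes "CARD('a::{field,finite}) = 2 ^ h"
  shows "trace2 h (x::'a) = 0 \<longleftrightarrow> (\<exists>\<mu>. \<mu>^2 + \<mu> = x)"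
proof -
  have two: "(2::'a) = 0"
    by (rule two_eq_zero_if_card_eq_power_two[OF assms])
  define K where "K = {x::'a. trace2 h x = 0}"
  define S where "S = range (\<lambda>\<mu>::'a. \<mu>^2 + \<mu>)"
  have "S \<subseteq> K"
    by (auto simp: S_def K_def trace2_add[OF two] trace2_square[OF assms] char2_add_self[OF two])
  have "CARD('a) \<le> (\<Sum>s\<in>S. card {\<mu>. \<mu>^2 + \<mu> = s})"
    by (rule order_trans[OF _ card_UN_le]) (auto simp: S_def intro!: card_mono)
  also have "\<dots> \<le> (\<Sum>s\<in>S. 2)"
    by (rule sum_mono) (rule card_artin_schreier_fibre_le[OF two])
  finally have "card K \<le> card S"
    using card_trace2_zeros_le[OF assms] by (simp add: K_def mult.commute)
  then have "S = K"
    using \<open>S \<subseteq> K\<close> by (simp add: card_seteq)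
  then show ?thesis
    unfolding S_def K_def by (metis (mono_tags, lifting) mem_Collect_eq rangeE rangeI)
qed

definition trace_char :: "nat \<Rightarrow> 'a::field \<Rightarrow> int" where
  "trace_char h x = (if trace2 h x = 0 then 1 else -1)"

lemma trace_char_0 [simp]: "trace_char h (0::'a::field) = 1"
  by (simp add: trace_char_def)

lemma trace_char_add:
  assumes "CARD('a::{field,finite}) = 2 ^ h"
  shows "trace_char h ((x::'a) + y) = trace_char h x * trace_char h y"
proof -
  have two: "(2::'a) = 0"
    by (rule two_eq_zero_if_card_eq_power_two[OF assms])
  show ?thesis
    using trace2_eq_0_or_1[OF assms, of x] trace2_eq_0_or_1[OF assms, of y] trace2_add[OF two, of h x y]
    by (auto simp: trace_char_def char2_add_self[OF two])
qed

lemma trace_char_square: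
  assumes "CARD('a::{field,finite}) = 2 ^ h"
  shows "trace_char h ((x::'a)^2) = trace_char h x"
  by (simp add: trace_char_def trace2_square[OF assms])

section \<open>The forms \<open>\<langle>-, -\<rangle>\<close> and \<open>\<vartheta>\<^sub>a\<close> in coordinates\<close>

lemma sum_UNIV_Plus:
  "(\<Sum>i\<in>UNIV. f i) = (\<Sum>k\<in>UNIV. f (Inl k)) + (\<Sum>k\<in>UNIV. f (Inr k))"
  for f :: "'m::finite + 'n::finite \<Rightarrow> 'b::comm_monoid_add"
  using sum.Plus[of UNIV UNIV f] by (simp add: comp_def)

lemma bform_eq_double_sum: "bform M u v = (\<Sum>i\<in>UNIV. \<Sum>j\<in>UNIV. u $ i * M $ i $ j * v $ j)"
proof -
  have "bform M u v = (\<Sum>j\<in>UNIV. \<Sum>i\<in>UNIV. u $ i * M $ i $ j * v $ j)"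
    by (simp add: bform_def vector_matrix_mult_def sum_distrib_left sum_distrib_right mult_ac)
  also have "\<dots> = (\<Sum>i\<in>UNIV. \<Sum>j\<in>UNIV. u $ i * M $ i $ j * v $ j)"
    by (rule sum.swap)
  finally show ?thesis .
qed

lemma mult_indicator_mult: "x * (if P then 1 else 0) * y = (if P then x * y else (0::'a::semiring_1))"
  by simp

lemma pairing_eq:
  "pairing u v = (\<Sum>k\<in>UNIV. u $ Inl k * v $ Inr k + u $ Inr k * v $ Inl k)"
proof -
  have "pairing u v = (\<Sum>i\<in>UNIV. \<Sum>j\<in>UNIV. u $ i * matF $ i $ j * v $ j)"
    by (simp add: pairing_def bform_eq_double_sum)
  also have "\<dots> = (\<Sum>k\<in>UNIV. u $ Inl k * v $ Inr k) + (\<Sum>k\<in>UNIV. u $ Inr k * v $ Inl k)"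
    by (simp add: matF_def sum_UNIV_Plus mult_indicator_mult)
  finally show ?thesis
    by (simp add: sum.distrib)
qed

lemma theta0_eq: "theta0 u = (\<Sum>k\<in>UNIV. u $ Inl k * u $ Inr k)"
  by (simp add: theta0_def matE_def bform_eq_double_sum sum_UNIV_Plus mult_indicator_mult)

lemma pairing_add_left: "pairing (u + v) w = pairing u w + pairing v w"
  by (simp add: pairing_eq sum.distrib[symmetric] algebra_simps)

lemma pairing_add_right: "pairing w (u + v) = pairing w u + pairing w v"
  by (simp add: pairing_eq sum.distrib[symmetric] algebra_simps)

lemma pairing_diff_right: "pairing w (u - v) = pairing w u - pairing w v"
  by (simp add: pairing_eq sum_subtractf[symmetric] algebra_simps)

lemma pairing_scale_left: "pairing (c *s u) w = c * pairing u w"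
  by (simp add: pairing_eq sum_distrib_left algebra_simps)

lemma pairing_scale_right: "pairing w (c *s u) = c * pairing w u"
  by (simp add: pairing_eq sum_distrib_left algebra_simps)

lemma pairing_commute: "pairing u w = pairing w u"
  by (simp add: pairing_eq algebra_simps)

lemma pairing_0_left [simp]: "pairing 0 w = 0"
  by (simp add: pairing_eq)

lemma pairing_0_right [simp]: "pairing w 0 = 0"
  by (simp add: pairing_eq)

lemma pairing_self:
  assumes "(2::'a::field) = 0"
  shows "pairing u u = (0::'a)"
  using assms by (simp add: pairing_eq mult.commute[of "u $ Inr _"] char2_add_self)

lemma pairing_axis_Inl: "pairing u (axis (Inl k) 1) = u $ Inr k"
proof -
  have "pairing u (axis (Inl k) 1) = (\<Sum>k'\<in>UNIV. if k' = k then u $ Inr k' else 0)"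
    unfolding pairing_eq by (intro sum.cong) (auto simp: axis_def)
  then show ?thesis
    by simp
qed

lemma pairing_axis_Inr: "pairing u (axis (Inr k) 1) = u $ Inl k"
proof -
  have "pairing u (axis (Inr k) 1) = (\<Sum>k'\<in>UNIV. if k' = k then u $ Inl k' else 0)"
    unfolding pairing_eq by (intro sum.cong) (auto simp: axis_def)
  then show ?thesis
    by simp
qed

lemma pairing_nondegenerate:
  assumes "\<And>w. pairing u w = 0"
  shows "u = 0"
proof (rule vec_eq_iff[THEN iffD2], rule allI)
  fix i
  show "u $ i = 0 $ i"
    using assms[of "axis (Inr _) 1"] assms[of "axis (Inl _) 1"]
    by (cases i) (simp_all add: pairing_axis_Inl pairing_axis_Inr)
qed

lemma pairing_left_eqI:
  assumes "\<And>w. pairing a w = pairing b w"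
  shows "a = b"
proof -
  have "pairing (a - b) w = 0" for w
    using assms[of w] by (simp add: pairing_commute[of _ w] pairing_diff_right)
  then show ?thesis
    using pairing_nondegenerate[of "a - b"] by simp
qed

lemma theta0_add: "theta0 (u + v) = theta0 u + theta0 v + pairing u v"
  by (simp add: theta0_eq pairing_eq sum.distrib[symmetric] algebra_simps)

lemma theta0_scale: "theta0 (c *s u) = c^2 * theta0 u"
  by (simp add: theta0_eq sum_distrib_left algebra_simps power2_eq_square)

lemma theta_0 [simp]: "theta 0 = theta0"
  by (simp add: theta_def fun_eq_iff)

lemma theta_add:
  assumes "(2::'a::field) = 0"
  shows "theta a (u + v) = theta a u + theta a v + pairing u (v::'a^('m::finite+'m))"
  by (simp add: theta_def theta0_add pairing_add_right char2_power2_add[OF assms] algebra_simps)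

lemma theta_scale: "theta a (c *s u) = c^2 * theta a u"
  by (simp add: theta_def theta0_scale pairing_scale_right algebra_simps power_mult_distrib)

section \<open>Gauss sums and the Arf invariant\<close>

lemma vec_linearI:
  fixes f :: "'a::field^'n \<Rightarrow> 'a^'k"
  assumes "\<And>x y. f (x + y) = f x + f y" and "\<And>c x. f (c *s x) = c *s f x"
  shows "Vector_Spaces.linear (*s) (*s) f"
  by unfold_locales (use assms in auto)

lemma card_subspace:
  fixes U :: "('a::{field,finite}^'n) set"
  assumes "vec.subspace U"
  shows "card U = CARD('a) ^ vec.dim U"
proof -
  obtain B where B: "B \<subseteq> U" "vec.independent B" "U \<subseteq> vec.span B" "card B = vec.dim U"
    using vec.basis_exists by blast
  define g where "g c = (\<Sum>v\<in>B. c v *s v)" for c :: "_ \<Rightarrow> 'a"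
  have "inj_on g (B \<rightarrow>\<^sub>E UNIV)"
  proof (rule inj_onI)
    fix c d
    assume c: "c \<in> B \<rightarrow>\<^sub>E UNIV" and d: "d \<in> B \<rightarrow>\<^sub>E UNIV" and "g c = g d"
    then have "(\<Sum>v\<in>B. (c v - d v) *s v) = 0"
      by (simp add: g_def vector_sub_rdistrib sum_subtractf)
    then have "\<forall>v\<in>B. c v - d v = 0"
      using B(2) unfolding vec.independent_explicit by (blast dest: spec[of _ "\<lambda>v. c v - d v"])
    then show "c = d"
      using c d by (intro PiE_ext) auto
  qed
  moreover have "g ` (B \<rightarrow>\<^sub>E UNIV) = U"
  proof -
    have "g c \<in> g ` (B \<rightarrow>\<^sub>E UNIV)" for c
    proof -
      have "g c = g (restrict c B)"
        by (simp add: g_def)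
      then show ?thesis
        by auto
    qed
    then have "g ` (B \<rightarrow>\<^sub>E UNIV) = range g"
      by blast
    also have "\<dots> = vec.span B"
      by (simp add: g_def vec.span_finite)
    also have "\<dots> = U"
      using B(1,3) assms vec.span_subspace by blast
    finally show ?thesis .
  qed
  ultimately have "card U = card (B \<rightarrow>\<^sub>E (UNIV :: 'a set))"
    using card_image by fastforce
  then show ?thesis
    by (simp add: card_PiE B(4))
qed

lemma sum_subspace_translate:
  assumes "vec.subspace U" "w \<in> U"
  shows "(\<Sum>v\<in>U. f (v + w)) = (\<Sum>v\<in>U. f (v::'a::field^'n))"
  by (rule sum.reindex_bij_witness[of _ "\<lambda>v. v - w" "\<lambda>v. v + w"])
    (use assms in \<open>auto intro: vec.subspace_add vec.subspace_diff\<close>)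

lemma sum_trace_char_linear_form:
  fixes f :: "'a::{field,finite}^'n \<Rightarrow> 'a"
  assumes card: "CARD('a) = 2 ^ h" and U: "vec.subspace U"
    and add: "\<And>x y. f (x + y) = f x + f y" and scale: "\<And>c x. f (c *s x) = c * f x"
  shows "(\<Sum>u\<in>U. trace_char h (f u)) = (if \<forall>u\<in>U. f u = 0 then int (card U) else 0)"
proof (cases "\<forall>u\<in>U. f u = 0")
  case False
  then obtain u\<^sub>0 where u\<^sub>0: "u\<^sub>0 \<in> U" "f u\<^sub>0 \<noteq> 0"
    by blast
  obtain t :: 'a where t: "trace2 h t = 1"
    using trace2_eq_1_exists[OF card] by blast
  define w where "w = (t / f u\<^sub>0) *s u\<^sub>0"
  have "w \<in> U" "trace_char h (f w) = -1"
    using U u\<^sub>0 t by (simp_all add: w_def scale vec.subspace_scale trace_char_def)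
  have "(\<Sum>u\<in>U. trace_char h (f u)) = (\<Sum>u\<in>U. trace_char h (f (u + w)))"
    by (rule sum_subspace_translate[OF U \<open>w \<in> U\<close>, symmetric])
  also have "\<dots> = - (\<Sum>u\<in>U. trace_char h (f u))"
    by (simp add: add trace_char_add[OF card] \<open>trace_char h (f w) = -1\<close> sum_negf)
  finally show ?thesis
    using False by (subst if_not_P) auto
qed simp

definition pairing_perp :: "('a::field^('m::finite+'m)) set \<Rightarrow> ('a^('m+'m)) set" where
  "pairing_perp U = {v. \<forall>u\<in>U. pairing v u = 0}"

lemma sum_trace_char_pairing:
  assumes "CARD('a::{field,finite}) = 2 ^ h" and "vec.subspace U"
  shows "(\<Sum>u\<in>U. trace_char h (pairing (v::'a^('m::finite+'m)) u)) =
    (if v \<in> pairing_perp U then int (card U) else 0)"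
  using sum_trace_char_linear_form[OF assms, of "pairing v"]
  by (simp add: pairing_add_right pairing_scale_right pairing_perp_def)

lemma card_pairing_perp:
  fixes U :: "('a::{field,finite}^('m::finite+'m)) set"
  assumes card: "CARD('a) = 2 ^ h" and U: "vec.subspace U"
  shows "card (pairing_perp U) * card U = CARD('a) ^ (2 * CARD('m))"
proof -
  let ?S = "\<Sum>v\<in>UNIV. \<Sum>u\<in>U. trace_char h (pairing v u)"
  have "?S = (\<Sum>v\<in>UNIV. if v \<in> pairing_perp U then int (card U) else 0)"
    by (simp add: sum_trace_char_pairing[OF card U])
  also have "\<dots> = int (card (pairing_perp U) * card U)"
    by (simp add: sum.If_cases)
  finally have S_perp: "?S = int (card (pairing_perp U) * card U)" .
  have "?S = (\<Sum>u\<in>U. \<Sum>v\<in>UNIV. trace_char h (pairing u v))"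
    by (subst sum.swap) (simp add: pairing_commute)
  also have "\<dots> = (\<Sum>u\<in>U. if u = 0 then int (CARD('a^('m+'m))) else 0)"
    using sum_trace_char_pairing[OF card vec.subspace_UNIV, where 'm='m]
    by (intro sum.cong refl) (auto simp: pairing_perp_def intro: pairing_nondegenerate)
  also have "\<dots> = int (CARD('a) ^ (2 * CARD('m)))"
    using vec.subspace_0[OF U] by (simp add: sum.delta mult_2)
  finally show ?thesis
    using S_perp by linarith
qed

text \<open>A totally singular subspace of dimension \<open>m\<close> is its own orthogonal, and the Gauss sum of
  \<open>\<vartheta>\<^sub>a\<close> localises on it.\<close>

lemma sum_trace_char_theta_lagrangian:
  fixes a :: "'a::{field,finite}^('m::finite+'m)"
  assumes card: "CARD('a) = 2 ^ h" and U: "vec.subspace U"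
    and dim_U: "vec.dim U = CARD('m)" and singular: "\<forall>u\<in>U. theta a u = 0"
  shows "(\<Sum>v\<in>UNIV. trace_char h (theta a v)) = int (CARD('a) ^ CARD('m))"
proof -
  have two: "(2::'a) = 0"
    by (rule two_eq_zero_if_card_eq_power_two[OF card])
  have card_U: "card U = CARD('a) ^ CARD('m)"
    using card_subspace[OF U] dim_U by simp
  have "pairing u v = 0" if "u \<in> U" "v \<in> U" for u v
    using theta_add[OF two, of a u v] singular that vec.subspace_add[OF U that] by simp
  then have "U \<subseteq> pairing_perp U"
    by (auto simp: pairing_perp_def)
  moreover have "card (pairing_perp U) = card U"
    using card_pairing_perp[OF card U] card_U by (simp add: power_mult power2_eq_square power_mult_distrib)
  ultimately have perp: "pairing_perp U = U"
    using card_seteq[of "pairing_perp U" U] by simp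
  let ?S = "\<Sum>v\<in>UNIV. trace_char h (theta a v)"
  have "?S * int (card U) = (\<Sum>u\<in>U. \<Sum>v\<in>UNIV. trace_char h (theta a (v + u)))"
    using sum_subspace_translate[OF vec.subspace_UNIV, of _ "\<lambda>v. trace_char h (theta a v)"]
    by (simp add: mult.commute)
  also have "\<dots> = (\<Sum>v\<in>UNIV. trace_char h (theta a v) * (\<Sum>u\<in>U. trace_char h (pairing v u)))"
    using singular
    by (subst sum.swap) (simp add: theta_add[OF two] trace_char_add[OF card] sum_distrib_left)
  also have "\<dots> = (\<Sum>v\<in>UNIV. if v \<in> U then int (card U) else 0)"
    using singular by (intro sum.cong refl) (simp add: sum_trace_char_pairing[OF card U] perp)
  also have "\<dots> = int (card U) * int (card U)"
    by (simp add: sum.If_cases)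
  finally show ?thesis
    using card_U by simp
qed

lemma sum_trace_char_theta0_eq:
  fixes a :: "'a::{field,finite}^('m::finite+'m)"
  assumes card: "CARD('a) = 2 ^ h"
  shows "(\<Sum>v\<in>UNIV. trace_char h (theta0 (v::'a^('m+'m)))) =
    trace_char h (theta0 a) * (\<Sum>v\<in>UNIV. trace_char h (theta a v))"
proof -
  have "(\<Sum>v\<in>UNIV. trace_char h (theta0 (v::'a^('m+'m)))) =
      (\<Sum>v\<in>UNIV. trace_char h (theta0 (v + a)))"
    using sum_subspace_translate[where w = a and f = "\<lambda>v. trace_char h (theta0 v)",
        OF vec.subspace_UNIV UNIV_I] by simp
  also have "\<dots> = (\<Sum>v\<in>UNIV. trace_char h (theta0 a) * trace_char h (theta a v))"
    by (simp add: theta0_add theta_def trace_char_add[OF card] trace_char_square[OF card]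
        pairing_commute[of a] mult_ac)
  finally show ?thesis
    by (simp add: sum_distrib_left)
qed

definition first_half :: "('a::field^('m::finite+'m)) set" where
  "first_half = {x. \<forall>k. x $ Inr k = 0}"

lemma subspace_first_half: "vec.subspace first_half"
  by (simp add: vec.subspace_def first_half_def)

lemma dim_first_half: "vec.dim (first_half :: ('a::field^('m::finite+'m)) set) = CARD('m)"
proof -
  have eq: "(first_half :: ('a^('m+'m)) set) = {x. \<forall>i. i \<notin> range Inl \<longrightarrow> x $ i = 0}"
    by (auto simp: first_half_def) (metis rangeI sum.exhaust)
  show ?thesis
    unfolding eq dim_substandard_cart by (simp add: card_image)
qed

lemma theta0_first_half: "u \<in> first_half \<Longrightarrow> theta0 u = 0"
  by (simp add: first_half_def theta0_eq)

lemma trace_theta0_eq_0_if_totally_singular: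
  fixes a :: "'a::{field,finite}^('m::finite+'m)"
  assumes card: "CARD('a) = 2 ^ h" and "totally_singular_dim (theta a) UNIV CARD('m)"
  shows "trace2 h (theta0 a) = 0"
proof -
  obtain U where U: "vec.subspace U" "vec.dim U = CARD('m)" "\<forall>u\<in>U. theta a u = 0"
    using assms(2) by (auto simp: totally_singular_dim_def)
  have "(trace_char h (theta0 a) - 1) * int (CARD('a) ^ CARD('m)) = 0"
    using sum_trace_char_theta0_eq[OF card, of a] sum_trace_char_theta_lagrangian[OF card U]
      sum_trace_char_theta_lagrangian[OF card subspace_first_half
        dim_first_half[where 'a='a and 'm='m], of 0]
    by (simp add: theta0_first_half algebra_simps)
  then have "trace_char h (theta0 a) = 1"
    by simp
  then show ?thesis
    by (simp add: trace_char_def split: if_splits)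
qed

section \<open>Totally singular subspaces of \<open>\<vartheta>\<^sub>a\<close>\<close>

text \<open>Write \<open>\<vartheta>\<^sub>0(a) = \<mu>\<^sup>2 + \<mu>\<close>; then \<open>l = \<mu>/\<vartheta>\<^sub>0(a)\<close> solves
  \<open>l + l\<^sup>2\<vartheta>\<^sub>0(a) = 1\<close>, and the involution \<open>u \<mapsto> u + l\<langle>a, u\<rangle>a\<close> carries \<open>\<vartheta>\<^sub>0\<close>
  to \<open>\<vartheta>\<^sub>a\<close>.\<close>

lemma theta_isometric_theta0:
  fixes a :: "'a::{field,finite}^('m::finite+'m)"
  assumes card: "CARD('a) = 2 ^ h" and trace: "trace2 h (theta0 a) = 0"
  shows "\<exists>T :: 'a^('m+'m) \<Rightarrow> 'a^('m+'m).
    Vector_Spaces.linear (*s) (*s) T \<and> inj T \<and> (\<forall>u. theta a (T u) = theta0 u)"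
proof -
  have two: "(2::'a) = 0"
    by (rule two_eq_zero_if_card_eq_power_two[OF card])
  let ?t = "theta0 a"
  obtain l where l: "l + l^2 * ?t = 1"
  proof (cases "?t = 0")
    case False
    obtain \<mu> where "\<mu>^2 + \<mu> = ?t"
      using trace trace2_eq_0_iff[OF card] by blast
    then have "\<mu> / ?t + (\<mu> / ?t)^2 * ?t = 1"
      using False by (simp add: field_simps power2_eq_square)
    then show ?thesis
      by (rule that)
  qed (use that[of 1] in simp)
  define T where "T u = u + (l * pairing a u) *s a" for u
  have pairing_T: "pairing a (T u) = pairing a u" for u
    by (simp add: T_def pairing_add_right pairing_scale_right pairing_self[OF two])
  have TT: "T (T u) = u" for u
  proof -
    have "T (T u) = u + (l * pairing a u + l * pairing a u) *s a"
      unfolding T_def pairing_T[unfolded T_def] by (simp only: add.assoc vector_sadd_rdistrib)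
    then show ?thesis
      by (simp add: char2_add_self[OF two])
  qed
  have theta0_T: "theta0 (T u) = theta a u" for u
  proof -
    have "theta0 (T u) = theta0 u + (pairing a u)^2 * (l + l^2 * ?t)"
      by (simp add: T_def theta0_add theta0_scale pairing_scale_right pairing_commute[of u a]
          algebra_simps power2_eq_square)
    then show ?thesis
      by (simp add: l theta_def)
  qed
  show ?thesis
  proof (intro exI conjI allI)
    show "Vector_Spaces.linear (*s) (*s) T"
      by (rule vec_linearI)
        (simp_all add: T_def pairing_add_right pairing_scale_right algebra_simps vector_sadd_rdistrib)
    show "inj T"
      by (metis TT injI)
    show "theta a (T u) = theta0 u" for u
      using theta0_T[of "T u"] by (simp add: TT)
  qed
qed

lemma totally_singular_theta_if_trace_eq_0:
  fixes a :: "'a::{field,finite}^('m::finite+'m)"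
  assumes card: "CARD('a) = 2 ^ h" and "trace2 h (theta0 a) = 0"
  shows "totally_singular_dim (theta a) UNIV CARD('m)"
proof -
  obtain T :: "'a^('m+'m) \<Rightarrow> 'a^('m+'m)"
    where T: "Vector_Spaces.linear (*s) (*s) T" "inj T" "\<And>u. theta a (T u) = theta0 u"
    using theta_isometric_theta0[OF assms] by blast
  have "inj_on T (vec.span first_half)"
    using T(2) by (rule inj_on_subset) simp
  then have "vec.dim (T ` first_half) = CARD('m)"
    by (simp add: vec.dim_image_eq[OF T(1)] dim_first_half)
  moreover have "vec.subspace (T ` first_half)"
    by (rule vec.linear_subspace_image[OF T(1) subspace_first_half])
  ultimately show ?thesis
    unfolding totally_singular_dim_def
    by (intro exI[of _ "T ` first_half"]) (auto simp: T(3) theta0_first_half)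
qed

lemma dim_pairing_kernel:
  assumes S: "vec.subspace S"
  shows "vec.dim S \<le> vec.dim {u \<in> S. pairing a u = 0} + 1"
proof (cases "\<forall>v\<in>S. pairing a v = 0")
  case False
  then obtain v where v: "v \<in> S" "pairing a v \<noteq> 0"
    by blast
  let ?K = "{u \<in> S. pairing a u = 0}"
  have "S \<subseteq> vec.span (insert v ?K)"
  proof
    fix u
    assume "u \<in> S"
    define c where "c = pairing a u / pairing a v"
    have "u - c *s v \<in> ?K"
      using v \<open>u \<in> S\<close> S
      by (simp add: c_def pairing_diff_right pairing_scale_right vec.subspace_diff vec.subspace_scale)
    then have "u - c *s v \<in> vec.span ?K"
      by (rule vec.span_base)
    then show "u \<in> vec.span (insert v ?K)"
      unfolding vec.span_breakdown_eq by blast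
  qed
  then have "vec.dim S \<le> vec.dim (vec.span (insert v ?K))"
    by (rule vec.dim_subset)
  also have "\<dots> = vec.dim (insert v ?K)"
    by (rule vec.dim_span)
  also have "\<dots> \<le> vec.dim ?K + 1"
    by (simp add: vec.dim_insert)
  finally show ?thesis .
next
  case True
  then have "{u \<in> S. pairing a u = 0} = S"
    by blast
  then show ?thesis
    by simp
qed

lemma totally_singular_theta_codim1:
  fixes a :: "'a::field^('m::finite+'m)"
  shows "totally_singular_dim (theta a) UNIV (CARD('m) - 1)"
proof -
  let ?K = "{u \<in> first_half. pairing a u = 0}"
  have "vec.subspace ?K"
    using subspace_first_half
    by (auto simp: vec.subspace_def pairing_add_right pairing_scale_right)
  have "CARD('m) - 1 \<le> vec.dim ?K"
    using dim_pairing_kernel[OF subspace_first_half, of a] dim_first_half[where 'a='a and 'm='m]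
    by simp
  then obtain U where "vec.subspace U" "U \<subseteq> vec.span ?K" "vec.dim U = CARD('m) - 1"
    by (rule vec.choose_subspace_of_subspace)
  moreover have "theta a u = 0" if "u \<in> vec.span ?K" for u
    using that vec.span_eq_iff[THEN iffD2, OF \<open>vec.subspace ?K\<close>]
    by (simp add: theta_def theta0_first_half)
  ultimately show ?thesis
    unfolding totally_singular_dim_def by (intro exI[of _ U]) auto
qed

section \<open>The hyperplanes \<open>H\<^sub>a\<close>\<close>

definition graph_emb :: "'a::field^('m::finite+'m) \<Rightarrow> 'a^('m+'m) \<Rightarrow> 'a^(('m+'m)+unit)" where
  "graph_emb a u = (\<chi> j. case j of Inl i \<Rightarrow> u $ i | Inr _ \<Rightarrow> pairing a u)"

definition base_proj :: "'a::field^(('m::finite+'m)+unit) \<Rightarrow> 'a^('m+'m)" where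
  "base_proj x = (\<chi> i. x $ Inl i)"

text \<open>The hyperplane \<open>H\<^sub>a: z = \<langle>a, u\<rangle>\<close> of \<open>PG(2m, q)\<close> attached to the vertex \<open>a\<close>.\<close>

definition graph_hyperplane :: "'a::field^('m::finite+'m) \<Rightarrow> ('a^(('m+'m)+unit)) set" where
  "graph_hyperplane a = range (graph_emb a)"

lemma base_proj_graph_emb [simp]: "base_proj (graph_emb a u) = u"
  by (simp add: base_proj_def graph_emb_def vec_eq_iff)

lemma graph_emb_last [simp]: "graph_emb a u $ Inr t = pairing a u"
  by (simp add: graph_emb_def)

lemma base_proj_zero [simp]: "base_proj 0 = 0"
  by (simp add: base_proj_def vec_eq_iff)

lemma base_proj_add [simp]: "base_proj (x + y) = base_proj x + base_proj y"
  by (simp add: base_proj_def vec_eq_iff)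

lemma base_proj_scale [simp]: "base_proj (c *s x) = c *s base_proj x"
  by (simp add: base_proj_def vec_eq_iff)

lemma base_proj_linear: "Vector_Spaces.linear (*s) (*s) base_proj"
  by (rule vec_linearI) simp_all

lemma vec_eq_base_projI:
  fixes x y :: "'a::field^(('m::finite+'m)+unit)"
  assumes "base_proj x = base_proj y" and "x $ Inr () = y $ Inr ()"
  shows "x = y"
proof (rule vec_eq_iff[THEN iffD2], rule allI)
  fix j
  show "x $ j = y $ j"
    using assms by (cases j) (auto simp: base_proj_def vec_eq_iff)
qed

lemma graph_emb_linear: "Vector_Spaces.linear (*s) (*s) (graph_emb a)"
  by (rule vec_linearI)
    (simp_all add: graph_emb_def vec_eq_iff pairing_add_right pairing_scale_right split: sum.split)

lemma inj_graph_emb: "inj (graph_emb a)"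
  by (metis injI base_proj_graph_emb)

lemma Qpar_eq: "Qpar x = theta0 (base_proj x) + (x $ Inr ())^2"
  by (simp add: Qpar_def theta0_eq base_proj_def)

lemma Qpar_graph_emb: "Qpar (graph_emb a u) = theta a u"
  by (simp add: Qpar_eq theta_def)

lemma polar_Qpar:
  assumes "(2::'a::field) = 0"
  shows "polar Qpar x y = pairing (base_proj x) (base_proj (y::'a^(('m::finite+'m)+unit)))"
  by (simp add: polar_def Qpar_eq theta0_add char2_power2_add[OF assms])

lemma subspace_graph_hyperplane: "vec.subspace (graph_hyperplane a)"
  unfolding graph_hyperplane_def
  by (rule vec.linear_subspace_image[OF graph_emb_linear vec.subspace_UNIV])

lemma dim_image_graph_emb: "vec.dim (graph_emb a ` S) = vec.dim S"
  by (rule vec.dim_image_eq[OF graph_emb_linear inj_on_subset[OF inj_graph_emb subset_UNIV]])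

lemma hyperplane_graph_hyperplane: "hyperplane (graph_hyperplane a)"
  unfolding hyperplane_def graph_hyperplane_def
  by (simp add: subspace_graph_hyperplane[unfolded graph_hyperplane_def] dim_image_graph_emb
      vec_dim_card card_cart_basis)

lemma nucleus_not_in_graph_hyperplane:
  assumes "(2::'a::field) = 0"
  shows "nucleus_not_in Qpar (graph_hyperplane (a::'a^('m::finite+'m)))"
proof -
  let ?n = "axis (Inr ()) 1 :: 'a^(('m+'m)+unit)"
  have "base_proj ?n = 0"
    by (simp add: base_proj_def vec_eq_iff axis_def)
  moreover have "?n \<notin> graph_hyperplane a"
  proof
    assume "?n \<in> graph_hyperplane a"
    then obtain u where u: "?n = graph_emb a u"
      by (auto simp: graph_hyperplane_def)
    then have "u = 0"
      using \<open>base_proj ?n = 0\<close> by simp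
    then show False
      using arg_cong[OF u, of "\<lambda>x. x $ Inr ()"] by simp
  qed
  ultimately show ?thesis
    unfolding nucleus_not_in_def by (intro exI[of _ ?n]) (simp add: polar_Qpar[OF assms])
qed

lemma not_singular_on_graph_hyperplane:
  assumes "(2::'a::field) = 0"
  shows "\<not> singular_on Qpar (graph_hyperplane (a::'a^('m::finite+'m)))"
proof
  assume "singular_on Qpar (graph_hyperplane a)"
  then obtain u where "graph_emb a u \<noteq> 0" "\<forall>v. polar Qpar (graph_emb a u) (graph_emb a v) = 0"
    by (auto simp: singular_on_def graph_hyperplane_def)
  then show False
    using pairing_nondegenerate[of u] vec.linear_0[OF graph_emb_linear]
    by (auto simp: polar_Qpar[OF assms])
qed

lemma inj_graph_hyperplane: "inj graph_hyperplane"
proof (rule injI)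
  fix a b :: "'a::field^('m::finite+'m)"
  assume "graph_hyperplane a = graph_hyperplane b"
  then have "graph_emb a u \<in> range (graph_emb b)" for u
    by (auto simp: graph_hyperplane_def)
  then have "pairing a u = pairing b u" for u
    by (metis graph_emb_last base_proj_graph_emb imageE)
  then show "a = b"
    by (rule pairing_left_eqI)
qed

lemma bij_base_proj_if_nucleus_not_in:
  fixes H :: "('a::field^(('m::finite+'m)+unit)) set"
  assumes two: "(2::'a) = 0" and hyp: "hyperplane H" and nucleus: "nucleus_not_in Qpar H"
  shows "bij_betw base_proj H UNIV"
proof -
  have H: "vec.subspace H" and dim_H: "vec.dim H = CARD('m+'m)"
    using hyp by (simp_all add: hyperplane_def)
  obtain n where n: "\<forall>w. polar Qpar n w = 0" "n \<notin> H"
    using nucleus by (auto simp: nucleus_not_in_def)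
  have "pairing (base_proj n) v = 0" for v
    using n(1) polar_Qpar[OF two, of n "graph_emb 0 v"] by simp
  then have "base_proj n = 0"
    by (rule pairing_nondegenerate)
  have "x = 0" if "x \<in> H" "base_proj x = 0" for x
  proof (rule ccontr)
    assume "x \<noteq> 0"
    then have "x $ Inr () \<noteq> 0"
      using vec_eq_base_projI[of x 0] \<open>base_proj x = 0\<close> by auto
    then have "n = (n $ Inr () / x $ Inr ()) *s x"
      using \<open>base_proj x = 0\<close> \<open>base_proj n = 0\<close> by (intro vec_eq_base_projI) simp_all
    then show False
      using n(2) vec.subspace_scale[OF H \<open>x \<in> H\<close>] by metis
  qed
  then have inj: "inj_on base_proj H"
    by (simp add: vec.linear_inj_on_iff_eq_0[OF base_proj_linear H])
  then have "vec.dim (base_proj ` H) = CARD('m+'m)"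
    by (simp add: vec.dim_image_eq[OF base_proj_linear] dim_H vec.span_eq_iff[THEN iffD2, OF H])
  then have "base_proj ` H = UNIV"
    using vec.linear_subspace_image[OF base_proj_linear H]
    by (intro vec.subspace_dim_equal) (simp_all add: vec_dim_card card_cart_basis)
  with inj show ?thesis
    by (simp add: bij_betw_def)
qed

lemma linear_component_eq_pairing:
  fixes G :: "'a::field^('m::finite+'m) \<Rightarrow> 'a^'n"
  assumes "Vector_Spaces.linear (*s) (*s) G"
  shows "\<exists>a. \<forall>v. G v $ j = pairing a v"
proof (intro exI allI)
  let ?a = "\<chi> i. case i of Inl k \<Rightarrow> G (axis (Inr k) 1) $ j | Inr k \<Rightarrow> G (axis (Inl k) 1) $ j"
  fix v
  have "G v $ j = (\<Sum>i\<in>UNIV. v $ i * G (axis i 1) $ j)"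
    by (rule linear_componentwise[OF assms])
  also have "\<dots> = pairing ?a v"
    by (simp add: sum_UNIV_Plus pairing_eq sum.distrib algebra_simps)
  finally show "G v $ j = pairing ?a v" .
qed

lemma graph_hyperplane_if_bij_base_proj:
  fixes H :: "('a::field^(('m::finite+'m)+unit)) set"
  assumes H: "vec.subspace H" and bij: "bij_betw base_proj H UNIV"
  shows "\<exists>a. H = graph_hyperplane a"
proof -
  obtain G where G: "range G \<subseteq> H" "Vector_Spaces.linear (*s) (*s) G" "\<forall>x\<in>H. G (base_proj x) = x"
    using vec.linear_exists_left_inverse_on[OF base_proj_linear H] bij by (auto simp: bij_betw_def)
  obtain a where a: "\<And>v. G v $ Inr () = pairing a v"
    using linear_component_eq_pairing[OF G(2)] by blast
  have "base_proj (G v) = v" for v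
  proof -
    obtain x where "x \<in> H" "v = base_proj x"
      using bij by (auto simp: bij_betw_def)
    then show ?thesis
      using G(3) by simp
  qed
  then have "G = graph_emb a"
    by (intro ext vec_eq_base_projI) (simp_all add: a)
  then have "H = graph_hyperplane a"
    using G(1,3) by (auto simp: graph_hyperplane_def) (metis rangeI)
  then show ?thesis
    by blast
qed

section \<open>Adjacency\<close>

lemma graph_emb_eq_iff: "graph_emb a u = graph_emb b v \<longleftrightarrow> u = v \<and> pairing a u = pairing b u"
proof
  assume eq: "graph_emb a u = graph_emb b v"
  then have "u = v"
    by (metis base_proj_graph_emb)
  moreover have "pairing a u = pairing b v"
    using arg_cong[OF eq, of "\<lambda>x. x $ Inr ()"] by simp
  ultimately show "u = v \<and> pairing a u = pairing b u"
    by simp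
qed (auto intro: vec_eq_base_projI)

lemma graph_emb_eq_0_iff [simp]: "graph_emb a u = 0 \<longleftrightarrow> u = 0"
  by (metis base_proj_graph_emb base_proj_zero vec.linear_0[OF graph_emb_linear])

lemma graph_hyperplane_Int:
  fixes a b :: "'a::field^('m::finite+'m)"
  assumes "(2::'a) = 0"
  shows "graph_hyperplane a \<inter> graph_hyperplane b = graph_emb a ` {u. pairing (a + b) u = 0}"
  by (auto simp: graph_hyperplane_def graph_emb_eq_iff pairing_add_left
      char2_add_eq_0_iff[OF assms])

lemma pairing_orthogonal_imp_multiple:
  assumes "c \<noteq> 0" and orth: "\<And>w. pairing c w = 0 \<Longrightarrow> pairing u w = 0"
  shows "\<exists>l. u = l *s c"
proof -
  obtain w\<^sub>0 where "pairing c w\<^sub>0 \<noteq> 0"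
    using pairing_nondegenerate \<open>c \<noteq> 0\<close> by blast
  define w\<^sub>1 where "w\<^sub>1 = (1 / pairing c w\<^sub>0) *s w\<^sub>0"
  have "pairing c w\<^sub>1 = 1"
    using \<open>pairing c w\<^sub>0 \<noteq> 0\<close> by (simp add: w\<^sub>1_def pairing_scale_right)
  have "pairing u w = pairing (pairing u w\<^sub>1 *s c) w" for w
  proof -
    have "pairing c (w - pairing c w *s w\<^sub>1) = 0"
      using \<open>pairing c w\<^sub>1 = 1\<close> by (simp add: pairing_diff_right pairing_scale_right)
    then have "pairing u (w - pairing c w *s w\<^sub>1) = 0"
      by (rule orth)
    then show ?thesis
      by (simp add: pairing_diff_right pairing_scale_right pairing_scale_left)
  qed
  then show ?thesis
    by (blast intro: pairing_left_eqI)
qed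

lemma NO_adj_graph_hyperplane:
  assumes two: "(2::'a::field) = 0"
  shows "NO_adj (graph_hyperplane a) (graph_hyperplane b) \<longleftrightarrow>
    theta a (a + b) = 0 \<and> a \<noteq> (b::'a^('m::finite+'m))"
proof -
  let ?C = "{u. pairing (a + b) u = 0}"
  have "NO_adj (graph_hyperplane a) (graph_hyperplane b) \<longleftrightarrow>
    (\<exists>u\<in>?C. u \<noteq> 0 \<and> theta a u = 0 \<and> (\<forall>w\<in>?C. pairing u w = 0))"
    by (simp add: NO_adj_def graph_hyperplane_Int[OF two] singular_on_def Qpar_graph_emb
        polar_Qpar[OF two])
  also have "\<dots> \<longleftrightarrow> theta a (a + b) = 0 \<and> a \<noteq> b"
  proof
    assume "\<exists>u\<in>?C. u \<noteq> 0 \<and> theta a u = 0 \<and> (\<forall>w\<in>?C. pairing u w = 0)"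
    then obtain u where u: "u \<noteq> 0" "theta a u = 0" "\<forall>w\<in>?C. pairing u w = 0"
      by blast
    have "a + b \<noteq> 0"
    proof
      assume "a + b = 0"
      then have "pairing u w = 0" for w
        using u(3) by simp
      then show False
        using u(1) pairing_nondegenerate by blast
    qed
    then obtain l where l: "u = l *s (a + b)"
      using pairing_orthogonal_imp_multiple u(3) by blast
    then have "l \<noteq> 0"
      using u(1) by auto
    moreover have "l^2 * theta a (a + b) = 0"
      using u(2) by (simp only: l theta_scale)
    ultimately show "theta a (a + b) = 0 \<and> a \<noteq> b"
      using \<open>a + b \<noteq> 0\<close> by (auto simp: vec_char2_add_eq_0_iff[OF two])
  next
    assume "theta a (a + b) = 0 \<and> a \<noteq> b"
    moreover from this have "a + b \<noteq> 0"
      by (simp add: vec_char2_add_eq_0_iff[OF two])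
    ultimately show "\<exists>u\<in>?C. u \<noteq> 0 \<and> theta a u = 0 \<and> (\<forall>w\<in>?C. pairing u w = 0)"
      by (intro bexI[of _ "a + b"]) (simp_all add: pairing_self[OF two])
  qed
  finally show ?thesis .
qed

lemma totally_singular_graph_hyperplane:
  "totally_singular_dim Qpar (graph_hyperplane a) d \<longleftrightarrow> totally_singular_dim (theta a) UNIV d"
proof
  assume "totally_singular_dim Qpar (graph_hyperplane a) d"
  then obtain U where U: "vec.subspace U" "U \<subseteq> graph_hyperplane a" "vec.dim U = d"
    "\<forall>x\<in>U. Qpar x = 0"
    by (auto simp: totally_singular_dim_def)
  have "graph_emb a ` (graph_emb a -` U) = U"
    using U(2) by (auto simp: graph_hyperplane_def)
  then have "vec.dim (graph_emb a -` U) = d"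
    using dim_image_graph_emb U(3) by metis
  moreover have "vec.subspace (graph_emb a -` U)"
    by (rule vec.linear_subspace_vimage[OF graph_emb_linear U(1)])
  ultimately show "totally_singular_dim (theta a) UNIV d"
    unfolding totally_singular_dim_def using U(4)
    by (intro exI[of _ "graph_emb a -` U"]) (simp add: Qpar_graph_emb[symmetric])
next
  assume "totally_singular_dim (theta a) UNIV d"
  then obtain U where U: "vec.subspace U" "vec.dim U = d" "\<forall>u\<in>U. theta a u = 0"
    by (auto simp: totally_singular_dim_def)
  then show "totally_singular_dim Qpar (graph_hyperplane a) d"
    unfolding totally_singular_dim_def
    by (intro exI[of _ "graph_emb a ` U"])
      (auto simp: vec.linear_subspace_image[OF graph_emb_linear] dim_image_graph_emb
        graph_hyperplane_def Qpar_graph_emb)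
qed

lemma quadric_type_graph_hyperplane:
  assumes card: "CARD('a::{field,finite}) = 2 ^ h"
  shows "quadric_type Qpar (graph_hyperplane a) CARD('m) s \<longleftrightarrow>
    a \<in> (Wset h s :: ('a^('m::finite+'m)) set)"
  using trace2_eq_0_or_1[OF card, of "theta0 a"]
    trace_theta0_eq_0_if_totally_singular[OF card, of a]
    totally_singular_theta_if_trace_eq_0[OF card, of a]
    totally_singular_theta_codim1[of a]
  by (auto simp: quadric_type_def Wset_def totally_singular_graph_hyperplane)

lemma graph_hyperplane_in_NO_vertices_iff:
  assumes card: "CARD('a::{field,finite}) = 2 ^ h"
  shows "graph_hyperplane a \<in> NO_vertices s \<longleftrightarrow> a \<in> (Wset h s :: ('a^('m::finite+'m)) set)"
  using two_eq_zero_if_card_eq_power_two[OF card]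
  by (simp add: NO_vertices_def hyperplane_graph_hyperplane nucleus_not_in_graph_hyperplane
      not_singular_on_graph_hyperplane quadric_type_graph_hyperplane[OF card])

lemma NO_vertices_subset_graph_hyperplanes:
  assumes "(2::'a::field) = 0"
  shows "NO_vertices s \<subseteq> range (graph_hyperplane :: 'a^('m::finite+'m) \<Rightarrow> _)"
proof
  fix H :: "('a^(('m+'m)+unit)) set"
  assume "H \<in> NO_vertices s"
  then have "vec.subspace H" "bij_betw base_proj H UNIV"
    using bij_base_proj_if_nucleus_not_in[OF assms]
    by (auto simp: NO_vertices_def hyperplane_def)
  then show "H \<in> range graph_hyperplane"
    using graph_hyperplane_if_bij_base_proj by blast
qed

theorem lemma3p4:
  fixes h :: nat and s :: bool
  assumes "CARD('a::{field,finite}) = 2 ^ h"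
  shows "graph_iso (Wset h s :: ('a ^ ('m::finite + 'm)) set) (Fedges h s)
                   (NO_vertices s :: ('a ^ (('m + 'm) + unit)) set set) NO_adj"
proof -
  have two: "(2::'a) = 0"
    by (rule two_eq_zero_if_card_eq_power_two[OF assms])
  have "graph_hyperplane ` Wset h s = (NO_vertices s :: ('a ^ (('m + 'm) + unit)) set set)"
    using graph_hyperplane_in_NO_vertices_iff[OF assms]
      NO_vertices_subset_graph_hyperplanes[OF two, where s = s]
    by blast
  then have "bij_betw graph_hyperplane (Wset h s :: ('a ^ ('m + 'm)) set) (NO_vertices s)"
    by (simp add: bij_betw_def inj_on_subset[OF inj_graph_hyperplane subset_UNIV])
  moreover have "(a, b) \<in> Fedges h s \<longleftrightarrow> NO_adj (graph_hyperplane a) (graph_hyperplane b)"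
    if "a \<in> Wset h s" "b \<in> Wset h s" for a b :: "'a ^ ('m + 'm)"
    using that by (simp add: Fedges_def NO_adj_graph_hyperplane[OF two])
  ultimately show ?thesis
    unfolding graph_iso_def by blast
qed

end
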